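(* In online matching with online items and non-myopic offline agents with public graph edges, every prompt deterministic truthful mechanism has competitive ratio at least $\nu=\min(m,n)$, where $n$ is the number of buyers and $m$ the number of items.
   Context: Model. There is a bipartite graph $G=(B,I;E)$ with a set $B$ of $n$ buyers, known in advance, and a set $I$ of $m$ items arriving one by one in an unknown, possibly adversarial order (item $j$ arrives at time $j$). Buyer $i$ is interested in the items $j$ with $(i,j)\in E$, and has a private value $v_i\ge 0$ for obtaining at least one item she is interested in (value $0$ otherwise). Public graph edges: when item $j$ arrives, the true set of buyers interested in $j$ is revealed to the mechanism (buyers cannot misreport edges); the only private information of buyer $i$ is $v_i$, and her report is a single value $b_i$ which she cannot change once declared. A deterministic mechanism decides upon the arrival of $j$, immediately and irrevocably and using only information on items up to $j$, either to assign $j$ to a buyer interested in it who has not been assigned an item yet, or to leave $j$ unassigned forever. The result is a matching $\mu$ ($\mu^{-1}_i$ is the item received by $i$, $\emptyset$ if none). The mechanism also charges non-negative payments $p_i$; it is prompt if $p_i$ is determined upon the arrival of the item assigned to $i$, using only information available at that time. Welfare. $\mathrm{SW}(\mu)=\sum_{i\in B} v_i\cdot \mathbb{I}[(i,\mu^{-1}_i)\in E]$, and $\mathrm{OPT}=\mathrm{SW}(\mu^\star)$ where $\mu^\star$ is a maximum weight matching in $G$. A mechanism is $\alpha$-competitive ($\alpha\ge 1$) on instances with $n$ buyers and $m$ items if $\mathrm{OPT}\le\alpha\cdot \mathrm{SW}(\mu)$ on all such instances (with truthful reports); its competitive ratio is the infimum of such $\alpha$ ($+\infty$ if none exists). Truthfulness.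 Non-myopic buyers know the whole sequence of items and maximize the quasi-linear utility $u_i=v_i\cdot\mathbb{I}[(i,\mu_i^{-1})\in E]-p_i$. A deterministic mechanism is truthful if, for every instance and every behavior of the other buyers, each agent maximizes her utility by reporting truthfully. Mechanisms are required to be individually rational: truthful agents have non-negative utility. *)

theory Defs
  imports "HOL-Library.Extended_Real" "HOL-Library.Cardinality"
begin

text \<open>
  The buyers are the elements of the finite type \<open>'b\<close>, so \<open>n = CARD('b)\<close>.  An instance with
  \<open>m\<close> items is given by a list \<open>N\<close> of length \<open>m\<close> together with a valuation \<open>v\<close>: the items are
  \<open>0, \<dots>, m - 1\<close> in order of arrival, and \<open>N ! j\<close> is the set of buyers interested in item \<open>j\<close>.
\<close>

definition edges :: "'b set list \<Rightarrow> ('b \<times> nat) set" where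
  "edges N = {(i, j). j < length N \<and> i \<in> N ! j}"

definition matching :: "'b set list \<Rightarrow> ('b \<times> nat) set \<Rightarrow> bool" where
  "matching N \<mu> \<longleftrightarrow> \<mu> \<subseteq> edges N \<and>
     (\<forall>i j j'. (i, j) \<in> \<mu> \<longrightarrow> (i, j') \<in> \<mu> \<longrightarrow> j = j') \<and>
     (\<forall>i i' j. (i, j) \<in> \<mu> \<longrightarrow> (i', j) \<in> \<mu> \<longrightarrow> i = i')"

definition served :: "'b set list \<Rightarrow> ('b \<times> nat) set \<Rightarrow> 'b \<Rightarrow> bool" where
  "served N \<mu> i \<longleftrightarrow> (\<exists>j. (i, j) \<in> \<mu> \<and> (i, j) \<in> edges N)"

definition SW :: "'b::finite set list \<Rightarrow> ('b \<Rightarrow> real) \<Rightarrow> ('b \<times> nat) set \<Rightarrow> real" where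
  "SW N v \<mu> = (\<Sum>i\<in>UNIV. v i * of_bool (served N \<mu> i))"

definition OPT :: "'b::finite set list \<Rightarrow> ('b \<Rightarrow> real) \<Rightarrow> real" where
  "OPT N v = Max (SW N v ` {\<mu>. matching N \<mu>})"

lemma finite_matchings: "finite {\<mu>. matching (N :: 'b::finite set list) \<mu>}"
proof (rule finite_subset)
  show "{\<mu>. matching N \<mu>} \<subseteq> Pow (UNIV \<times> {..<length N})"
    by (auto simp: matching_def edges_def)
qed simp

lemma matching_empty: "matching N {}"
  by (simp add: matching_def)

text \<open>
  \<open>assign M b H\<close> is the decision taken at the arrival of the last item of the sequence \<open>H\<close>, where
  \<open>b\<close> is the profile of reports and \<open>H\<close> lists the interested buyers of all items that have arrived
  so far (\<open>None\<close>: the item stays unassigned).  Earlier decisions need not be an argument, as they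
  are determined by \<open>b\<close> and \<open>H\<close>.  \<open>pay M b N i\<close> is the payment charged to \<open>i\<close> on the complete
  sequence \<open>N\<close>; a priori it may depend on all of \<open>N\<close>.
\<close>

record 'b mechanism =
  assign :: "('b \<Rightarrow> real) \<Rightarrow> 'b set list \<Rightarrow> 'b option"
  pay :: "('b \<Rightarrow> real) \<Rightarrow> 'b set list \<Rightarrow> 'b \<Rightarrow> real"

definition outcome :: "'b mechanism \<Rightarrow> ('b \<Rightarrow> real) \<Rightarrow> 'b set list \<Rightarrow> ('b \<times> nat) set" where
  "outcome M b N = {(i, j). j < length N \<and> assign M b (take (Suc j) N) = Some i}"

definition utility ::
    "'b mechanism \<Rightarrow> 'b set list \<Rightarrow> 'b \<Rightarrow> real \<Rightarrow> ('b \<Rightarrow> real) \<Rightarrow> real" where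
  "utility M N i v\<^sub>i b = v\<^sub>i * of_bool (served N (outcome M b N) i) - pay M b N i"

text \<open>
  The following notions refer to instances with exactly \<open>m\<close> items, so that a mechanism may depend
  on \<open>m\<close>.  Values and reports are non-negative.
\<close>

definition feasible :: "nat \<Rightarrow> 'b mechanism \<Rightarrow> bool" where
  "feasible m M \<longleftrightarrow> (\<forall>N b. length N = m \<longrightarrow> (\<forall>i. 0 \<le> b i) \<longrightarrow>
     matching N (outcome M b N) \<and> (\<forall>i. 0 \<le> pay M b N i))"

definition prompt :: "nat \<Rightarrow> 'b mechanism \<Rightarrow> bool" where
  "prompt m M \<longleftrightarrow> (\<forall>N N' b i j. length N = m \<longrightarrow> length N' = m \<longrightarrow> (\<forall>k. 0 \<le> b k) \<longrightarrow>
     (i, j) \<in> outcome M b N \<longrightarrow> take (Suc j) N' = take (Suc j) N \<longrightarrow>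
     pay M b N' i = pay M b N i)"

definition truthful :: "nat \<Rightarrow> 'b mechanism \<Rightarrow> bool" where
  "truthful m M \<longleftrightarrow> (\<forall>N b i v\<^sub>i. length N = m \<longrightarrow> (\<forall>k. 0 \<le> b k) \<longrightarrow> 0 \<le> v\<^sub>i \<longrightarrow>
     utility M N i v\<^sub>i b \<le> utility M N i v\<^sub>i (b(i := v\<^sub>i)))"

definition individually_rational :: "nat \<Rightarrow> 'b mechanism \<Rightarrow> bool" where
  "individually_rational m M \<longleftrightarrow> (\<forall>N b i. length N = m \<longrightarrow> (\<forall>k. 0 \<le> b k) \<longrightarrow>
     0 \<le> utility M N i (b i) b)"

definition competitive :: "nat \<Rightarrow> 'b::finite mechanism \<Rightarrow> real \<Rightarrow> bool" where
  "competitive m M \<alpha> \<longleftrightarrow> (\<forall>N v. length N = m \<longrightarrow> (\<forall>i. 0 \<le> v i) \<longrightarrow>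
     OPT N v \<le> \<alpha> * SW N v (outcome M v N))"

text \<open>In \<^typ>\<open>ereal\<close> the infimum of the empty set is \<open>\<infinity>\<close>.\<close>

definition competitive_ratio :: "nat \<Rightarrow> 'b::finite mechanism \<Rightarrow> ereal" where
  "competitive_ratio m M = Inf {ereal \<alpha> | \<alpha>. 1 \<le> \<alpha> \<and> competitive m M \<alpha>}"

end

(* Let everybody be interested in the first item.  If no further items of interest arrive, a buyer
   with a huge report must get it, and by promptness her price p, which does not depend on her own
   report, is then fixed.  Since a buyer can always secure the first item at this price, truthfulness
   makes p her price whenever she is served, also by a later item.  So a buyer with value above p
   gets the first item (it might be the last one) and a buyer with value below p never gets any.
   Hence, unless some value ties with its price, only one buyer is served even if everybody is
   interested in every item.  On a grid of nearly equal values with more than n points per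
   coordinate, counting yields a profile without ties; there the optimum is about min m n times
   the welfare of the mechanism. *)

theory Submission
  imports Defs "HOL-Library.FuncSet"
begin

section \<open>Welfare bounds for outcomes and matchings\<close>

lemma served_outcome_iff:
  assumes "feasible m M" "length N = m" "\<And>k. 0 \<le> b k"
  shows "served N (outcome M b N) i \<longleftrightarrow> (\<exists>j. (i, j) \<in> outcome M b N)"
proof -
  have "outcome M b N \<subseteq> edges N"
    using assms by (simp add: feasible_def matching_def)
  then show ?thesis by (auto simp: served_def)
qed

lemma outcome_functional:
  "(i, j) \<in> outcome M b N \<Longrightarrow> (k, j) \<in> outcome M b N \<Longrightarrow> i = k"
  by (simp add: outcome_def)

lemma SW_le_OPT:
  assumes "matching N \<mu>"
  shows "SW N v \<mu> \<le> OPT N v"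
  unfolding OPT_def using assms by (intro Max_ge finite_imageI finite_matchings) auto

lemma SW_le_if_unique_served:
  assumes "\<And>i. served N \<mu> i \<Longrightarrow> i = w" "0 \<le> v w"
  shows "SW N v \<mu> \<le> v w"
proof -
  have "SW N v \<mu> \<le> (\<Sum>i\<in>UNIV. if i = w then v w else 0)"
    unfolding SW_def
  proof (rule sum_mono)
    fix i
    show "v i * of_bool (served N \<mu> i) \<le> (if i = w then v w else 0)"
      using assms(1)[of i] assms(2) by (cases "served N \<mu> i") auto
  qed
  then show ?thesis by simp
qed

lemma le_OPT_single:
  fixes v :: "'b::finite \<Rightarrow> real"
  assumes "N \<noteq> []" "i \<in> N ! 0"
  shows "v i \<le> OPT N v"
proof -
  have "matching N {(i, 0)}"
    using assms by (auto simp: matching_def edges_def)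
  moreover have "served N {(i, 0)} k \<longleftrightarrow> k = i" for k
    using assms by (auto simp: served_def edges_def)
  then have "SW N v {(i, 0)} = v i"
    by (simp add: SW_def of_bool_def if_distrib cong: if_cong)
  ultimately show ?thesis
    using SW_le_OPT by metis
qed

text \<open>Since everybody wants every item, any injection of \<open>min m CARD('b)\<close> buyers
  into the items is a matching, and each matched buyer contributes at least 1.\<close>

lemma OPT_replicate_UNIV_ge:
  fixes v :: "'b::finite \<Rightarrow> real"
  assumes "\<And>i. 1 \<le> v i"
  shows "real (min m CARD('b)) \<le> OPT (replicate m UNIV) v"
proof -
  let ?N = "replicate m (UNIV :: 'b set)"
  obtain A :: "'b set" where A: "card A = min m CARD('b)"
    using obtain_subset_with_card_n[of "min m CARD('b)" "UNIV :: 'b set"] by auto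
  obtain f where f: "bij_betw f A {..<min m CARD('b)}"
    using A finite_same_card_bij[of A "{..<min m CARD('b)}"] by auto
  define \<mu> where "\<mu> = (\<lambda>i. (i, f i)) ` A"
  have lt: "f i < m" if "i \<in> A" for i
    using bij_betwE[OF f] that by auto
  have "matching ?N \<mu>"
    using lt f by (auto simp: matching_def edges_def \<mu>_def bij_betw_def inj_on_def)
  moreover have "served ?N \<mu> i \<longleftrightarrow> i \<in> A" for i
    using lt by (auto simp: served_def edges_def \<mu>_def)
  then have "SW ?N v \<mu> = sum v A"
    by (simp add: SW_def of_bool_def if_distrib sum.If_cases cong: if_cong)
  moreover have "real (card A) \<le> sum v A"
    using sum_mono[of A "\<lambda>_. 1" v] assms by simp
  ultimately show ?thesis
    using SW_le_OPT[of ?N \<mu> v] A by simp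
qed

section \<open>Who gets the first item\<close>

text \<open>Items that interest nobody pad the sequence to length \<open>m\<close>. At the first
  arrival it cannot be told apart from any other sequence whose first item interests
  everybody.\<close>

definition single_item :: "nat \<Rightarrow> 'b set list" where
  "single_item m = UNIV # replicate (m - 1) {}"

lemma length_single_item: "0 < m \<Longrightarrow> length (single_item m) = m"
  by (simp add: single_item_def)

lemma take_single_item: "N \<noteq> [] \<Longrightarrow> N ! 0 = UNIV \<Longrightarrow> take (Suc 0) (single_item m) = take (Suc 0) N"
  by (cases N) (auto simp: single_item_def)

lemma outcome_first_item_cong:
  assumes "N \<noteq> []" "N' \<noteq> []" "take (Suc 0) N = take (Suc 0) N'"
  shows "(i, 0) \<in> outcome M b N \<longleftrightarrow> (i, 0) \<in> outcome M b N'"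
  using assms by (auto simp: outcome_def)

lemma outcome_single_item:
  assumes "feasible m M" "0 < m" "\<And>k. 0 \<le> b k" "(i, j) \<in> outcome M b (single_item m)"
  shows "j = 0"
proof -
  have "matching (single_item m) (outcome M b (single_item m))"
    using assms by (simp add: feasible_def length_single_item)
  then have "j < m" "i \<in> single_item m ! j"
    using assms(2,4) by (auto simp: matching_def edges_def length_single_item)
  then show ?thesis
    by (cases j) (auto simp: single_item_def)
qed

text \<open>On \<open>single_item m\<close> at most one buyer contributes to the welfare, and any
  buyer other than \<open>i\<close> contributes too little for ratio \<alpha>. The decision on item
  0 depends only on the reports and that item, so it carries over to \<open>N\<close>.\<close>

lemma dominant_report_gets_first_item:
  fixes M :: "'b::finite mechanism"
  assumes M: "feasible m M" "competitive m M \<alpha>"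
    and N: "length N = m" "N \<noteq> []" "N ! 0 = UNIV"
    and b: "\<And>k. 0 \<le> b k" "0 < b i" "\<And>k. k \<noteq> i \<Longrightarrow> \<alpha> * b k < b i"
    and "1 \<le> \<alpha>"
  shows "(i, 0) \<in> outcome M b N"
proof (rule ccontr)
  let ?S = "single_item m :: 'b set list"
  have m: "0 < m" using N by auto
  have S: "length ?S = m" "?S \<noteq> []" "?S ! 0 = UNIV"
    by (simp_all add: length_single_item m) (simp_all add: single_item_def)
  assume "(i, 0) \<notin> outcome M b N"
  then have not_i: "(i, 0) \<notin> outcome M b ?S"
    using outcome_first_item_cong[OF N(2) S(2)] take_single_item[OF N(2,3)] by metis
  have served: "served ?S (outcome M b ?S) k \<longleftrightarrow> (k, 0) \<in> outcome M b ?S" for k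
    using served_outcome_iff[of m M ?S b k] outcome_single_item[of m M b] M(1) S(1) b(1) m by metis
  have "b i \<le> OPT ?S b"
    by (rule le_OPT_single) (use S in auto)
  also have "\<dots> \<le> \<alpha> * SW ?S b (outcome M b ?S)"
    using M(2) S(1) b(1) by (simp add: competitive_def)
  also have "\<dots> < b i"
  proof (cases "\<exists>w. (w, 0) \<in> outcome M b ?S")
    case True
    then obtain w where w: "(w, 0) \<in> outcome M b ?S" by blast
    have "SW ?S b (outcome M b ?S) \<le> b w"
      using w b(1) by (intro SW_le_if_unique_served) (auto simp: served dest: outcome_functional)
    then have "\<alpha> * SW ?S b (outcome M b ?S) \<le> \<alpha> * b w"
      using \<open>1 \<le> \<alpha>\<close> by (intro mult_left_mono) auto
    also have "\<dots> < b i"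
      using w not_i by (intro b(3)) auto
    finally show ?thesis .
  next
    case False
    then have "SW ?S b (outcome M b ?S) = 0"
      by (simp add: SW_def served)
    then show ?thesis using b(2) by simp
  qed
  finally show False by simp
qed

section \<open>Prices forced by truthfulness\<close>

lemma pay_unserved:
  assumes "feasible m M" "individually_rational m M" "length N = m" "\<And>k. 0 \<le> b k"
    and "\<not> served N (outcome M b N) i"
  shows "pay M b N i = 0"
proof -
  have "0 \<le> utility M N i (b i) b" "0 \<le> pay M b N i"
    using assms by (auto simp: individually_rational_def feasible_def)
  then show ?thesis using assms(5) by (simp add: utility_def)
qed

text \<open>Otherwise a buyer with true value \<open>b i\<close> would get utility 0 by honesty and
  positive utility by reporting \<open>h\<close>.\<close>

lemma served_if_price_less:
  assumes "feasible m M" "truthful m M" "individually_rational m M" "length N = m"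
    and "\<And>k. 0 \<le> b k" "0 \<le> h"
    and "served N (outcome M (b(i := h)) N) i" "pay M (b(i := h)) N i < b i"
  shows "served N (outcome M b N) i"
proof (rule ccontr)
  assume ns: "\<not> served N (outcome M b N) i"
  have "utility M N i (b i) (b(i := h)) \<le> utility M N i (b i) ((b(i := h))(i := b i))"
    using assms(2,4-6) unfolding truthful_def by (metis fun_upd_apply)
  then show False
    using assms(7,8) ns pay_unserved[OF assms(1,3,4,5) ns] by (simp add: utility_def)
qed

text \<open>Here \<open>h\<close> is the true value and \<open>b i\<close> the lie. Both reports get
  her served, so the lie cannot be cheaper, and individual rationality at \<open>b i\<close> caps
  its price by \<open>b i\<close>.\<close>

lemma price_le_if_served:
  assumes "truthful m M" "individually_rational m M" "length N = m"
    and "\<And>k. 0 \<le> b k" "0 \<le> h"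
    and "served N (outcome M (b(i := h)) N) i" "served N (outcome M b N) i"
  shows "pay M (b(i := h)) N i \<le> b i"
proof -
  have "utility M N i h b \<le> utility M N i h (b(i := h))"
    using assms(1,3-5) by (simp add: truthful_def)
  moreover have "0 \<le> utility M N i (b i) b"
    using assms(2-4) by (simp add: individually_rational_def)
  ultimately show ?thesis
    using assms(6,7) by (simp add: utility_def)
qed

text \<open>By promptness, the price at report \<open>h\<close> is the same on \<open>N\<close> and
  on \<open>single_item m\<close>. Being served on \<open>N\<close> puts \<open>b i\<close> strictly
  above it, as there is no tie, so she must also be served on \<open>single_item m\<close>. There
  only item 0 can serve her, and that assignment is made on \<open>N\<close> as well.\<close>

lemma served_only_by_first_item:
  fixes M :: "'b mechanism"
  assumes M: "feasible m M" "prompt m M" "truthful m M" "individually_rational m M"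
    and N: "length N = m" "N \<noteq> []" "N ! 0 = UNIV"
    and b: "\<And>k. 0 \<le> b k" "0 \<le> h"
    and win: "(i, 0) \<in> outcome M (b(i := h)) N"
    and no_tie: "b i \<noteq> pay M (b(i := h)) N i"
    and served: "served N (outcome M b N) i"
  shows "(i, 0) \<in> outcome M b N"
proof -
  let ?S = "single_item m :: 'b set list"
  let ?b = "b(i := h)"
  have m: "0 < m" using N by auto
  have S: "length ?S = m" "?S \<noteq> []"
    by (simp_all add: length_single_item m) (simp_all add: single_item_def)
  have pre: "take (Suc 0) ?S = take (Suc 0) N"
    using take_single_item[OF N(2,3)] .
  have b': "0 \<le> ?b k" for k using b by simp
  have winS: "(i, 0) \<in> outcome M ?b ?S"
    using win outcome_first_item_cong[OF S(2) N(2) pre] by metis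
  have pay: "pay M ?b ?S i = pay M ?b N i"
    using M(2) N(1) S(1) b' win pre unfolding prompt_def by blast
  have "served N (outcome M ?b N) i"
    using served_outcome_iff[OF M(1) N(1), of ?b] b' win by blast
  then have "pay M ?b N i < b i"
    using price_le_if_served[OF M(3,4) N(1) b _ served] no_tie by force
  then have "served ?S (outcome M b ?S) i"
    using served_outcome_iff[OF M(1) S(1), of ?b] b' winS pay
    by (intro served_if_price_less[OF M(1,3,4) S(1) b]) auto
  then have "(i, 0) \<in> outcome M b ?S"
    using served_outcome_iff[OF M(1) S(1), of b] outcome_single_item[OF M(1) m, of b] b(1) by metis
  then show ?thesis
    using outcome_first_item_cong[OF S(2) N(2) pre] by metis
qed

section \<open>A profile without ties\<close>

text \<open>As \<open>p i\<close> ignores coordinate \<open>i\<close>, the other coordinates leave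
  at most one tying value for it. With n buyers, at most n * \<open>card S ^ (n - 1)\<close>
  profiles of the grid have a tie, fewer than all \<open>card S ^ n\<close>.\<close>

lemma ex_profile_avoiding_ties:
  fixes p :: "'b::finite \<Rightarrow> ('b \<Rightarrow> 'a) \<Rightarrow> 'a"
  assumes S: "finite S" "CARD('b) < card S"
    and p: "\<And>i b x. p i (b(i := x)) = p i b"
  shows "\<exists>b. range b \<subseteq> S \<and> (\<forall>i. b i \<noteq> p i b)"
proof (rule ccontr)
  assume none: "\<not> ?thesis"
  let ?n = "CARD('b)"
  define F :: "('b \<Rightarrow> 'a) set" where "F = PiE UNIV (\<lambda>_. S)"
  define T where "T = (\<lambda>i. {b \<in> F. b i = p i b})"
  obtain s where s: "s \<in> S" using S by fastforce
  have F: "finite F" "card F = card S ^ ?n"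
    by (simp_all add: F_def S finite_PiE card_PiE)
  have card_T: "card (T i) \<le> card S ^ (?n - 1)" for i
  proof -
    let ?Q = "\<lambda>k. if k = i then {s} else S"
    \<comment> \<open>Overwriting coordinate \<open>i\<close> by the arbitrary point
      \<open>s\<close> loses nothing on \<open>T i\<close>: the tie recovers it from the other
      coordinates.\<close>
    have "inj_on (\<lambda>b. b(i := s)) (T i)"
    proof (rule inj_onI)
      fix b c assume bc: "b \<in> T i" "c \<in> T i" "b(i := s) = c(i := s)"
      then have "p i b = p i c" using p[of i b s] p[of i c s] by simp
      then have "b i = c i" using bc by (simp add: T_def)
      then show "b = c" using bc(3) by (metis fun_upd_triv fun_upd_upd)
    qed
    moreover have "(\<lambda>b. b(i := s)) ` T i \<subseteq> PiE UNIV ?Q"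
      by (auto simp: T_def F_def PiE_iff)
    moreover have "finite (PiE UNIV ?Q)"
      using S by (intro finite_PiE) auto
    ultimately have "card (T i) \<le> card (PiE UNIV ?Q)"
      using card_inj_on_le by blast
    also have "\<dots> = (\<Prod>k\<in>UNIV. card (?Q k))"
      by (simp add: card_PiE)
    also have "\<dots> = card S ^ (?n - 1)"
      by (subst prod.remove[of _ i]) (simp_all add: card_Diff_singleton)
    finally show ?thesis .
  qed
  have "F \<subseteq> (\<Union>i. T i)"
    using none by (fastforce simp: T_def F_def PiE_iff)
  then have "card F \<le> card (\<Union>i. T i)"
    using F(1) by (intro card_mono) (auto simp: T_def)
  also have "\<dots> \<le> (\<Sum>i\<in>UNIV. card (T i))"
    by (rule card_UN_le) simp
  also have "\<dots> \<le> ?n * card S ^ (?n - 1)"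
    using sum_mono[of UNIV "\<lambda>i. card (T i)", OF card_T] by simp
  also have "\<dots> < card S * card S ^ (?n - 1)"
    using S(2) by (intro mult_strict_right_mono) auto
  also have "\<dots> = card F"
    by (simp add: F(2) flip: power_Suc)
  finally show False by simp
qed

section \<open>The lower bound\<close>

lemma competitive_imp_min_le:
  fixes M :: "'b::finite mechanism"
  assumes M: "feasible m M" "prompt m M" "truthful m M" "individually_rational m M"
    and \<alpha>: "1 \<le> \<alpha>" "competitive m M \<alpha>"
  shows "real (min m CARD('b)) \<le> \<alpha>"
proof (rule ccontr)
  let ?\<nu> = "real (min m CARD('b))"
  let ?N = "replicate m (UNIV :: 'b set)"
  assume "\<not> ?\<nu> \<le> \<alpha>"
  then have less: "\<alpha> < ?\<nu>" by simp
  then have "m \<noteq> 0" using \<alpha>(1) by (intro notI) simp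
  then have N: "length ?N = m" "?N \<noteq> []" "?N ! 0 = UNIV" by auto
  \<comment> \<open>Values above 1 lift the optimum to \<open>?\<nu>\<close>; values below
    \<open>?\<nu> / \<alpha>\<close> make the welfare of a single served buyer too small.\<close>
  have "infinite {1 <..< ?\<nu> / \<alpha>}"
    using less \<alpha>(1) by (simp add: infinite_Ioo)
  then obtain S where S: "finite S" "card S = Suc CARD('b)" "S \<subseteq> {1 <..< ?\<nu> / \<alpha>}"
    using infinite_arbitrarily_large by blast
  (* A report of ?\<nu> is high enough to win the first item against any other values in S. *)
  obtain b where b: "range b \<subseteq> S" "\<And>i. b i \<noteq> pay M (b(i := ?\<nu>)) ?N i"
    using ex_profile_avoiding_ties[of S "\<lambda>i b. pay M (b(i := ?\<nu>)) ?N i"] S by auto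
  have b1: "1 < b i" and b\<nu>: "\<alpha> * b i < ?\<nu>" for i
  proof -
    have "b i \<in> {1 <..< ?\<nu> / \<alpha>}" using b(1) S(3) by blast
    then show "1 < b i" "\<alpha> * b i < ?\<nu>"
      using \<alpha>(1) by (auto simp: field_simps)
  qed
  have b0: "0 \<le> b i" for i using b1[of i] by simp
  have first: "(i, 0) \<in> outcome M b ?N" if "served ?N (outcome M b ?N) i" for i
  proof (rule served_only_by_first_item[OF M N b0 _ _ b(2) that])
    show "0 \<le> ?\<nu>" by simp
    show "(i, 0) \<in> outcome M (b(i := ?\<nu>)) ?N"
      using b0 b\<nu> less \<alpha>(1)
      by (intro dominant_report_gets_first_item[OF M(1) \<alpha>(2) N _ _ _ \<alpha>(1)])
        auto
  qed
  \<comment> \<open>All served buyers hold item 0, so there is at most one; if there is none,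
    \<open>w\<close> is arbitrary.\<close>
  obtain w where w: "\<And>i. served ?N (outcome M b ?N) i \<Longrightarrow> i = w"
    using first outcome_functional[of _ 0 M b ?N] by metis
  have "SW ?N b (outcome M b ?N) \<le> b w"
    using w b0 by (rule SW_le_if_unique_served)
  then have "\<alpha> * SW ?N b (outcome M b ?N) \<le> \<alpha> * b w"
    using \<alpha>(1) by (intro mult_left_mono) auto
  moreover have "?\<nu> \<le> OPT ?N b"
    using b1 by (intro OPT_replicate_UNIV_ge) (simp add: less_imp_le)
  moreover have "OPT ?N b \<le> \<alpha> * SW ?N b (outcome M b ?N)"
    using \<alpha>(2) b0 by (simp add: competitive_def)
  ultimately show False using b\<nu>[of w] by linarith
qed

theorem theorem4:
  fixes M :: "'b::finite mechanism" and m n :: nat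
  assumes "n = CARD('b)"
    and "feasible m M"
    and "prompt m M"
    and "truthful m M"
    and "individually_rational m M"
  shows "ereal (real (min m n)) \<le> competitive_ratio m M"
  unfolding competitive_ratio_def
proof (rule Inf_greatest, clarify)
  fix \<alpha> :: real
  assume "1 \<le> \<alpha>" "competitive m M \<alpha>"
  then have "real (min m n) \<le> \<alpha>"
    using competitive_imp_min_le[OF assms(2-5)] assms(1) by simp
  then show "ereal (real (min m n)) \<le> ereal \<alpha>" by simp
qed

end
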